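(* Let $\Gamma$ be a finite graph and let $G$ be a finite group acting on $\Gamma$ by graph automorphisms. Then $$F_{\Gamma}(G;x,y)=\sum_{g\in G}c_G(g)\,P_{\Gamma/g}(x,y),\qquad\text{where}\qquad c_G(g):=\sum_{\substack{H\leq G\\ g\in H}}\frac{1}{|H|}.$$
   Context: Graphs are finite and undirected; loops are allowed and parallel edges are irrelevant (only adjacency matters). For a graph $\Lambda$, the bivariate chromatic polynomial $P_\Lambda(x,y)$ (Dohmen–Pönitz–Tittmann) is the unique polynomial in $x,y$ such that, for all integers $x\ge y\ge 0$, $P_\Lambda(x,y)$ is the number of maps $c:V(\Lambda)\to\{1,\dots,x\}$ such that for every edge $uv$ of $\Lambda$ (including loops, $u=v$) with $c(u)=c(v)$ one has $c(u)>y$. Thus colours $1,\dots,y$ are "proper", colours $y+1,\dots,x$ are "improper", and a vertex carrying a loop can only receive an improper colour. For $g\in G$, the quotient graph $\Gamma/g$ has as vertices the $\langle g\rangle$-orbits on $V(\Gamma)$; two distinct orbits are adjacent iff at least one edge of $\Gamma$ joins them, and an orbit carries a loop iff some edge of $\Gamma$ has both endpoints in that orbit. The multiorbital bivariate chromatic polynomial of $\Gamma$ relative to $G$ is $$F_\Gamma(G;x,y):=\sum_{H\le G}\frac1{|H|}\sum_{h\in H}P_{\Gamma/h}(x,y),$$ the outer sum being over all subgroups $H$ of $G$. Identities are identities of polynomials in $x,y$ with rational coefficients. *)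

theory Defs
  imports
    "HOL-Algebra.Group_Action"
    "HOL-Algebra.Generated_Groups"
    "HOL-Computational_Algebra.Polynomial"
    "Graph_Theory.Pair_Digraph"
begin

text \<open>
  A finite undirected graph, loops allowed, is a \<^locale>\<open>pair_pseudo_graph\<close>, i.e. a finite vertex
  set with a symmetric adjacency relation; a loop at \<open>v\<close> is the pair \<open>(v, v)\<close>.  Only adjacency is
  recorded, so there are no parallel edges.
\<close>

definition bicolourings :: "'a pair_pre_digraph \<Rightarrow> nat \<Rightarrow> nat \<Rightarrow> ('a \<Rightarrow> nat) set" where
  "bicolourings \<Lambda> x y =
     {c \<in> pverts \<Lambda> \<rightarrow>\<^sub>E {1..x}. \<forall>(u, v) \<in> parcs \<Lambda>. c u = c v \<longrightarrow> c u > y}"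

text \<open>
  Polynomials in \<open>x, y\<close> with rational coefficients are elements of \<open>(\<rat>[x])[y]\<close>: the outer variable
  is \<open>y\<close>, the inner one is \<open>x\<close>.
\<close>

type_synonym bipoly = "rat poly poly"

definition bieval :: "bipoly \<Rightarrow> rat \<Rightarrow> rat \<Rightarrow> rat" where
  "bieval p x y = poly (poly p [:y:]) x"

text \<open>Existence and uniqueness are \<open>ex1_bivariate_chromatic\<close> below.\<close>

definition bivariate_chromatic :: "'a pair_pre_digraph \<Rightarrow> bipoly" where
  "bivariate_chromatic \<Lambda> =
     (THE p. \<forall>x y :: nat. y \<le> x \<longrightarrow>
        bieval p (of_nat x) (of_nat y) = of_nat (card (bicolourings \<Lambda> x y)))"

definition quotient_graph ::
    "('g, 'm) monoid_scheme \<Rightarrow> ('g \<Rightarrow> 'a \<Rightarrow> 'a) \<Rightarrow> 'a pair_pre_digraph \<Rightarrow> 'g \<Rightarrow> 'a set pair_pre_digraph"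
  where
  "quotient_graph G \<phi> \<Gamma> g =
     (let Orb = orbits (G\<lparr>carrier := generate G {g}\<rparr>) (pverts \<Gamma>) \<phi>
      in \<lparr>pverts = Orb,
          parcs = {(A, B). A \<in> Orb \<and> B \<in> Orb \<and> (\<exists>u \<in> A. \<exists>v \<in> B. (u, v) \<in> parcs \<Gamma>)}\<rparr>)"

definition multiorbital ::
    "('g, 'm) monoid_scheme \<Rightarrow> ('g \<Rightarrow> 'a \<Rightarrow> 'a) \<Rightarrow> 'a pair_pre_digraph \<Rightarrow> bipoly" where
  "multiorbital G \<phi> \<Gamma> =
     (\<Sum>H | subgroup H G. smult [:1 / of_nat (card H):]
        (\<Sum>h\<in>H. bivariate_chromatic (quotient_graph G \<phi> \<Gamma> h)))"

definition subgroup_weight :: "('g, 'm) monoid_scheme \<Rightarrow> 'g \<Rightarrow> rat" where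
  "subgroup_weight G g = (\<Sum>H | subgroup H G \<and> g \<in> H. 1 / of_nat (card H))"


section \<open>Well-definedness of the bivariate chromatic polynomial\<close>

lemma bieval_simps [simp]:
  "bieval (p + q) x y = bieval p x y + bieval q x y"
  "bieval (p - q) x y = bieval p x y - bieval q x y"
  "bieval (p * q) x y = bieval p x y * bieval q x y"
  "bieval (p ^ n) x y = bieval p x y ^ n"
  "bieval [:0, 1:] x y = y"
  "bieval [:[:0, 1:]:] x y = x"
  by (simp_all add: bieval_def poly_power)

lemma bipoly_eqI:
  assumes "\<And>x y :: nat. y \<le> x \<Longrightarrow>
    bieval p (of_nat x) (of_nat y) = bieval q (of_nat x) (of_nat y)"
  shows "p = q"
proof -
  define r where "r = p - q"
  have r0: "poly r [:of_nat y:] = 0" for y :: nat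
  proof (rule ccontr)
    assume "poly r [:of_nat y:] \<noteq> 0"
    then have "finite {x. poly (poly r [:of_nat y:]) x = 0}"
      by (rule poly_roots_finite)
    moreover have "of_nat ` {y..} \<subseteq> {x. poly (poly r [:of_nat y:]) x = 0}"
      using assms by (auto simp: r_def bieval_def)
    ultimately have "finite ((of_nat :: nat \<Rightarrow> rat) ` {y..})"
      by (rule rev_finite_subset)
    then show False
      by (simp add: finite_image_iff inj_on_def infinite_Ici)
  qed
  have "r = 0"
  proof (rule ccontr)
    assume "r \<noteq> 0"
    then have "finite {z. poly r z = 0}"
      by (rule poly_roots_finite)
    moreover have "range (\<lambda>y :: nat. [:of_nat y:]) \<subseteq> {z. poly r z = 0}"
      using r0 by auto
    ultimately have "finite (range (\<lambda>y :: nat. [:of_nat y :: rat:]))"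
      by (rule rev_finite_subset)
    then show False
      by (simp add: finite_image_iff inj_on_def)
  qed
  then show ?thesis by (simp add: r_def)
qed

definition violated :: "nat \<Rightarrow> ('a \<Rightarrow> nat) \<Rightarrow> 'a \<times> 'a \<Rightarrow> bool" where
  "violated y c e \<longleftrightarrow> c (fst e) = c (snd e) \<and> c (fst e) \<le> y"

lemma ex_bipoly_violated:
  assumes V: "finite V" and A: "A \<subseteq> V \<times> V"
  shows "\<exists>p. \<forall>x y :: nat. y \<le> x \<longrightarrow> bieval p (of_nat x) (of_nat y) =
           of_nat (card {c \<in> V \<rightarrow>\<^sub>E {1..x}. \<forall>e\<in>A. violated y c e})"
proof -
  define R where "R = {(u, v). u \<in> V \<and> v \<in> V \<and> (u, v) \<in> (A \<union> A\<inverse>)\<^sup>*}"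
  have symA: "sym ((A \<union> A\<inverse>)\<^sup>*)"
    by (intro sym_rtrancl) (auto simp: sym_def)
  have R: "equiv V R"
    unfolding R_def by (rule equivI)
      (auto simp: refl_on_def sym_def trans_def intro: symD[OF symA] rtrancl_trans)
  have RD: "(u, v) \<in> (A \<union> A\<inverse>)\<^sup>*" if "(u, v) \<in> R" for u v
    using that by (simp add: R_def)
  have AR: "A \<subseteq> R" using A by (auto simp: R_def)
  define K where "K = {C \<in> V // R. C \<inter> Field A \<noteq> {}}"
  have fin: "finite (V // R)"
    using V R by (metis equiv_def finite_quotient refl_on_def equiv_type)
  have finK: "finite K" using fin by (simp add: K_def)
  have KV: "K \<subseteq> V // R" by (auto simp: K_def)
  have "card {c \<in> V \<rightarrow>\<^sub>E {1..x}. \<forall>e\<in>A. violated y c e} = y ^ card K * x ^ card (V // R - K)"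
    if yx: "y \<le> x" for x y
  proof -
    define D where "D = (\<Pi>\<^sub>E C \<in> V // R. if C \<in> K then {1..y} else {1..x})"
    define f where "f d = (\<lambda>v\<in>V. d (R `` {v}))" for d :: "'a set \<Rightarrow> nat"
    have "bij_betw f D {c \<in> V \<rightarrow>\<^sub>E {1..x}. \<forall>e\<in>A. violated y c e}"
    proof (rule bij_betw_imageI)
      show "inj_on f D"
      proof (rule inj_onI)
        fix d d' assume d: "d \<in> D" "d' \<in> D" "f d = f d'"
        show "d = d'"
        proof (rule PiE_ext[OF d(1,2)[unfolded D_def]])
          fix C assume "C \<in> V // R"
          then obtain v where "v \<in> V" "C = R `` {v}" by (auto elim: quotientE)
          then show "d C = d' C" using fun_cong[OF d(3), of v] by (simp add: f_def)
        qed
      qed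
      show "f ` D = {c \<in> V \<rightarrow>\<^sub>E {1..x}. \<forall>e\<in>A. violated y c e}"
      proof (intro equalityI subsetI)
        fix c assume "c \<in> f ` D"
        then obtain d where d: "d \<in> D" and c: "c = f d" by auto
        have dx: "d (R `` {v}) \<in> {1..x}" if "v \<in> V" for v
          using d yx quotientI[OF that, of R] by (force simp: D_def PiE_iff split: if_splits)
        have "violated y c (u, v)" if "(u, v) \<in> A" for u v
        proof -
          have uv: "u \<in> V" "v \<in> V" using that A by auto
          have eq: "R `` {u} = R `` {v}" using that AR R by (meson equiv_class_eq subsetD)
          have "u \<in> R `` {u}" using equiv_class_self[OF R uv(1)] .
          then have "R `` {u} \<in> K"
            using uv that by (auto simp: K_def quotientI Field_def)
          then have "d (R `` {u}) \<le> y"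
            using d KV by (force simp: D_def PiE_iff)
          then show ?thesis using uv eq by (simp add: violated_def c f_def)
        qed
        then show "c \<in> {c \<in> V \<rightarrow>\<^sub>E {1..x}. \<forall>e\<in>A. violated y c e}"
          using dx by (auto simp: c f_def)
      next
        fix c assume c: "c \<in> {c \<in> V \<rightarrow>\<^sub>E {1..x}. \<forall>e\<in>A. violated y c e}"
        have const: "c u = c v" if "(u, v) \<in> (A \<union> A\<inverse>)\<^sup>*" for u v
          using that by (induction) (use c in \<open>force simp: violated_def\<close>)+
        define d where "d = (\<lambda>C\<in>V // R. c (SOME v. v \<in> C))"
        have dR: "d (R `` {v}) = c v" if "v \<in> V" for v
        proof -
          have "(SOME w. w \<in> R `` {v}) \<in> R `` {v}"
            using equiv_class_self[OF R that] by (rule someI)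
          then have "c v = c (SOME w. w \<in> R `` {v})"
            by (intro const RD) (simp only: Image_singleton_iff)
          then show ?thesis using that by (simp add: d_def quotientI)
        qed
        have "d \<in> D" unfolding D_def
        proof (rule PiE_I)
          fix C assume C: "C \<in> V // R"
          then obtain v where v: "v \<in> V" "C = R `` {v}" by (auto elim: quotientE)
          have "c v \<le> y" if "C \<in> K"
          proof -
            obtain w where w: "w \<in> C" "w \<in> Field A" using \<open>C \<in> K\<close> by (auto simp: K_def)
            then have "c w \<le> y" using c by (fastforce simp: Field_def violated_def)
            moreover have "c v = c w" using w v by (intro const RD) simp
            ultimately show ?thesis by simp
          qed
          moreover have "c v \<in> {1..x}" using c v by auto
          ultimately show "d C \<in> (if C \<in> K then {1..y} else {1..x})"
            using dR v by auto
        qed (auto simp: d_def)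
        moreover have "c = f d"
        proof
          fix v show "c v = f d v"
          proof (cases "v \<in> V")
            case True then show ?thesis by (simp add: f_def dR)
          next
            case False then show ?thesis using c by (auto simp: f_def PiE_def extensional_def)
          qed
        qed
        ultimately show "c \<in> f ` D" by blast
      qed
    qed
    then have "card {c \<in> V \<rightarrow>\<^sub>E {1..x}. \<forall>e\<in>A. violated y c e} = card D"
      by (simp add: bij_betw_same_card)
    also have "\<dots> = (\<Prod>C\<in>V // R. if C \<in> K then y else x)"
      unfolding D_def using fin by (subst card_PiE) (auto intro: prod.cong)
    also have "\<dots> = (\<Prod>C\<in>K. if C \<in> K then y else x) * (\<Prod>C\<in>V // R - K. if C \<in> K then y else x)"
      by (subst prod.subset_diff[OF KV fin]) (rule mult.commute)
    also have "\<dots> = y ^ card K * x ^ card (V // R - K)"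
      by simp
    finally show ?thesis .
  qed
  then show ?thesis
    by (intro exI[of _ "[:0, 1:] ^ card K * [:[:0, 1:]:] ^ card (V // R - K)"])
      (simp del: pCons_0_0)
qed

lemma ex_bipoly_satisfied_violated:
  assumes "finite E" "finite V" "E \<subseteq> V \<times> V" "A \<subseteq> V \<times> V"
  shows "\<exists>p. \<forall>x y :: nat. y \<le> x \<longrightarrow> bieval p (of_nat x) (of_nat y) =
           of_nat (card {c \<in> V \<rightarrow>\<^sub>E {1..x}. (\<forall>e\<in>A. violated y c e) \<and> (\<forall>e\<in>E. \<not> violated y c e)})"
  using assms(1,3,4)
proof (induction E arbitrary: A rule: finite_induct)
  case empty
  then show ?case using ex_bipoly_violated[OF \<open>finite V\<close>] by simp
next
  case (insert e E)
  define N where "N E A x y =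
    {c \<in> V \<rightarrow>\<^sub>E {1..x}. (\<forall>e\<in>A. violated y c e) \<and> (\<forall>e\<in>E. \<not> violated y c e)}" for E A x y
  obtain p where p: "\<And>x y. y \<le> x \<Longrightarrow> bieval p (of_nat x) (of_nat y) = of_nat (card (N E A x y))"
    using insert.IH[of A] insert.prems unfolding N_def by auto
  obtain q where q: "\<And>x y. y \<le> x \<Longrightarrow>
      bieval q (of_nat x) (of_nat y) = of_nat (card (N E (insert e A) x y))"
    using insert.IH[of "insert e A"] insert.prems unfolding N_def by auto
  have "card (N E A x y) = card (N (insert e E) A x y) + card (N E (insert e A) x y)" for x y
  proof -
    have fin: "finite (N E A x y)" for E A
      by (rule finite_subset[of _ "V \<rightarrow>\<^sub>E {1..x}"]) (auto simp: N_def assms(2) intro!: finite_PiE)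
    have "N E A x y = N (insert e E) A x y \<union> N E (insert e A) x y"
      by (auto simp: N_def)
    moreover have "N (insert e E) A x y \<inter> N E (insert e A) x y = {}"
      by (auto simp: N_def)
    ultimately show ?thesis using fin by (simp add: card_Un_disjoint)
  qed
  then show ?case unfolding N_def[symmetric]
    by (intro exI[of _ "p - q"]) (simp add: p q)
qed

theorem ex1_bivariate_chromatic:
  assumes "pair_fin_digraph \<Lambda>"
  shows "\<exists>!p. \<forall>x y :: nat. y \<le> x \<longrightarrow>
           bieval p (of_nat x) (of_nat y) = of_nat (card (bicolourings \<Lambda> x y))"
proof -
  interpret pair_fin_digraph \<Lambda> by fact
  have sub: "parcs \<Lambda> \<subseteq> pverts \<Lambda> \<times> pverts \<Lambda>"
    using wellformed' by auto
  have "bicolourings \<Lambda> x y = {c \<in> pverts \<Lambda> \<rightarrow>\<^sub>E {1..x}.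
      (\<forall>e\<in>{}. violated y c e) \<and> (\<forall>e\<in>parcs \<Lambda>. \<not> violated y c e)}" for x y
    by (force simp: bicolourings_def violated_def)
  then have "\<exists>p. \<forall>x y :: nat. y \<le> x \<longrightarrow>
      bieval p (of_nat x) (of_nat y) = of_nat (card (bicolourings \<Lambda> x y))"
    using ex_bipoly_satisfied_violated[OF pair_finite_arcs pair_finite_verts sub, of "{}"] by simp
  then show ?thesis
    by (auto intro!: bipoly_eqI)
qed

lemma bieval_bivariate_chromatic:
  assumes "pair_fin_digraph \<Lambda>" "y \<le> x"
  shows "bieval (bivariate_chromatic \<Lambda>) (of_nat x) (of_nat y) = of_nat (card (bicolourings \<Lambda> x y))"
  using theI'[OF ex1_bivariate_chromatic[OF assms(1)]] assms(2)
  unfolding bivariate_chromatic_def by blast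

lemma pair_pseudo_graph_quotient_graph:
  assumes "pair_pseudo_graph \<Gamma>"
  shows "pair_pseudo_graph (quotient_graph G \<phi> \<Gamma> g)"
proof -
  interpret pair_pseudo_graph \<Gamma> by fact
  define Orb where "Orb = orbits (G\<lparr>carrier := generate G {g}\<rparr>) (pverts \<Gamma>) \<phi>"
  have Q: "quotient_graph G \<phi> \<Gamma> g = \<lparr>pverts = Orb,
      parcs = {(A, B). A \<in> Orb \<and> B \<in> Orb \<and> (\<exists>u \<in> A. \<exists>v \<in> B. (u, v) \<in> parcs \<Gamma>)}\<rparr>"
    by (simp add: quotient_graph_def Orb_def Let_def)
  have "Orb = orbit (G\<lparr>carrier := generate G {g}\<rparr>) \<phi> ` pverts \<Gamma>"
    by (auto simp: Orb_def orbits_def)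
  then have fin: "finite Orb"
    using pair_finite_verts by simp
  show ?thesis
  proof
    show "finite (parcs (quotient_graph G \<phi> \<Gamma> g))"
      by (rule finite_subset[of _ "Orb \<times> Orb"]) (auto simp: Q fin)
    show "symmetric (with_proj (quotient_graph G \<phi> \<Gamma> g))"
      using arcs_symmetric by (fastforce simp: Q symmetric_def sym_def)
  qed (auto simp: Q fin)
qed

end

theory Submission
  imports Defs
begin

text \<open>
  Both sides sum \<open>P(\<Gamma>/h) / |H|\<close> over the pairs \<open>(H, h)\<close> with \<open>H\<close> a subgroup of \<open>G\<close> and \<open>h \<in> H\<close>:
  the left side groups the pairs by \<open>H\<close>, the right side by \<open>h\<close>.
\<close>

lemma sum_const_poly: "(\<Sum>i\<in>I. [:f i:]) = [:\<Sum>i\<in>I. f i:]"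
  by (induction I rule: infinite_finite_induct) simp_all

lemma finite_subgroups:
  assumes "finite (carrier G)"
  shows "finite {H. subgroup H G}"
  by (rule finite_subset[of _ "Pow (carrier G)"]) (auto simp: assms dest: subgroup.subset)

lemma sum_subgroups_averages:
  fixes G :: "('g, 'm) monoid_scheme" and P :: "'g \<Rightarrow> bipoly"
  assumes fin: "finite (carrier G)"
  shows "(\<Sum>H | subgroup H G. smult [:1 / of_nat (card H):] (\<Sum>h\<in>H. P h)) =
    (\<Sum>g\<in>carrier G. smult [:subgroup_weight G g:] (P g))"
proof -
  define t where "t H h = smult [:1 / of_nat (card H):] (P h)" for H :: "'g set" and h
  have "(\<Sum>H | subgroup H G. smult [:1 / of_nat (card H):] (\<Sum>h\<in>H. P h)) =
      (\<Sum>H | subgroup H G. \<Sum>h | h \<in> carrier G \<and> h \<in> H. t H h)"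
  proof (rule sum.cong)
    fix H assume "H \<in> {H. subgroup H G}"
    then have "{h. h \<in> carrier G \<and> h \<in> H} = H"
      by (auto dest: subgroup.subset)
    then show "smult [:1 / of_nat (card H):] (\<Sum>h\<in>H. P h) =
        (\<Sum>h | h \<in> carrier G \<and> h \<in> H. t H h)"
      using sum_distrib_left[of "[:[:1 / of_nat (card H):]:]" P H] by (simp add: t_def)
  qed simp
  also have "\<dots> = (\<Sum>h\<in>carrier G. \<Sum>H | H \<in> {H. subgroup H G} \<and> h \<in> H. t H h)"
    by (rule sum.swap_restrict[OF finite_subgroups[OF fin] fin])
  also have "\<dots> = (\<Sum>g\<in>carrier G. smult [:subgroup_weight G g:] (P g))"
    by (simp add: t_def subgroup_weight_def smult_sum flip: sum_const_poly)
  finally show ?thesis .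
qed

theorem proposition3p3:
  fixes \<Gamma> :: "'a pair_pre_digraph"
    and G :: "('g, 'm) monoid_scheme"
    and \<phi> :: "'g \<Rightarrow> 'a \<Rightarrow> 'a"
  assumes "pair_pseudo_graph \<Gamma>"
    and "group G" and "finite (carrier G)"
    and "group_action G (pverts \<Gamma>) \<phi>"
    and "\<And>g u v. g \<in> carrier G \<Longrightarrow> u \<in> pverts \<Gamma> \<Longrightarrow> v \<in> pverts \<Gamma> \<Longrightarrow>
           (\<phi> g u, \<phi> g v) \<in> parcs \<Gamma> \<longleftrightarrow> (u, v) \<in> parcs \<Gamma>"
  shows "multiorbital G \<phi> \<Gamma> =
    (\<Sum>g\<in>carrier G. smult [:subgroup_weight G g:]
       (bivariate_chromatic (quotient_graph G \<phi> \<Gamma> g)))"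
  unfolding multiorbital_def by (rule sum_subgroups_averages[OF assms(3)])

end
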